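(* Let $\sigma(n)=\sum_{d\mid n} d$ be the sum-of-divisors function. The following three statements hold. (1) Let $k\ge 2$ be an integer, let $a_1,\dots,a_k$ be positive integers, and let $b_1,\dots,b_k$ be integers such that $a_ib_j\ne a_jb_i$ for every $1\le i<j\le k$. Then for any positive constant $C$, the set of positive integers $n$ for which \[ \frac{\sigma(a_1n+b_1)}{\sigma(a_2n+b_2)} > C, \quad \frac{\sigma(a_2n+b_2)}{\sigma(a_3n+b_3)} > C, \quad\dots,\quad \frac{\sigma(a_{k-1}n+b_{k-1})}{\sigma(a_kn+b_k)} > C \] all hold has positive lower density. In particular, the set of positive integers $n$ for which \[ \sigma(a_1n+b_1) > \sigma(a_2n+b_2) > \dots > \sigma(a_kn+b_k) \] has positive lower density. (2) Let $k\ge 2$ be an integer and let $\varepsilon_1,\dots,\varepsilon_{k-1}\in\{-1,1\}$. Then the set of positive integers $n$ for which \[ \varepsilon_1(\sigma(n+1)-\sigma(n+2)) > 0,\quad \varepsilon_2(\sigma(n+2)-\sigma(n+3)) > 0,\quad \dots,\quad \varepsilon_{k-1}(\sigma(n+k-1)-\sigma(n+k)) > 0 \] all hold has positive lower density. (3) Let $a$ and $c$ be positive integers and let $b$ and $d$ be any integers such that $ad\ne bc$. Then for any positive integer $k$, the set of positive integers $n$ for which \[ \sigma\big(a(n+1)+b\big) > \sigma\big(c(n+1)+d\big),\quad \sigma\big(a(n+2)+b\big) > \sigma\big(c(n+2)+d\big),\quad \dots,\quad \sigma\big(a(n+k)+b\big) > \sigma\big(c(n+k)+d\big) \] all hold has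 positive lower density.
   Context: The lower density of a set $S$ of positive integers is $\liminf_{x\to\infty} \frac1x\#\{n\in S: n\le x\}$. Only those $n$ for which all arguments of $\sigma$ are positive are considered; this excludes only finitely many $n$ and does not affect lower density. *)

theory Defs
  imports Complex_Main "HOL-Library.Extended_Real"
begin

text \<open>The sum is over an infinite set when \<open>n = 0\<close>, so \<open>divisor_sum 0 = 0\<close> is a junk value.\<close>

definition divisor_sum :: "nat \<Rightarrow> nat" where
  "divisor_sum n = (\<Sum>d | d dvd n. d)"

definition lower_density :: "nat set \<Rightarrow> ereal" where
  "lower_density S = Liminf at_top (\<lambda>x::real. ereal (real (card {n \<in> S. real n \<le> x}) / x))"

end

theory Submission
  imports Defs "HOL-Number_Theory.Cong" "HOL-Analysis.Harmonic_Numbers"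
begin

text \<open>
  Write \<open>h(m) = \<sigma>(m) / m\<close>, and let \<open>L\<^sub>i(n) = a\<^sub>i n + b\<^sub>i\<close> be finitely many pairwise
  non-proportional linear forms, ranked by an integer-valued \<open>key\<close>.  All three statements follow from
  one: for every constant \<open>C\<close>, the \<open>n\<close> such that
  \<open>\<sigma>(L\<^sub>i(n)) > C \<sigma>(L\<^sub>j(n))\<close> whenever \<open>key j < key i\<close> have positive lower density
  (\<open>lower_density_ordered_divisor_sums\<close>).

  A lower bound for \<open>h(L\<^sub>i(n))\<close> is forced by divisibility: if \<open>N\<^sub>i\<close> divides \<open>L\<^sub>i(n)\<close>, then
  \<open>h(L\<^sub>i(n)) \<ge> h(N\<^sub>i)\<close>.  If the \<open>N\<^sub>i\<close> are coprime to each other, to the leading coefficients and to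
  the determinants \<open>a\<^sub>i b\<^sub>j - a\<^sub>j b\<^sub>i\<close>, then the Chinese remainder theorem gives a progression
  \<open>r + M t\<close> with \<open>M = \<Prod>N\<^sub>i\<close> on which all these divisibilities hold.
  An upper bound holds on average: on the progression \<open>L\<^sub>i\<close> becomes \<open>\<alpha>\<^sub>i + \<beta>\<^sub>i t\<close>, and summing
  \<open>h(m) = \<Sum>\<^bsub>d dvd m\<^esub> 1/d\<close> shows that its mean value is at most \<open>4 gcd(\<alpha>\<^sub>i, \<beta>\<^sub>i)\<close>
  (\<open>sum_abundancy_progression_le\<close>).  The coprimality conditions make this gcd a divisor of
  \<open>a\<^sub>i N\<^sub>i\<close>: the bound does not involve the other \<open>N\<^sub>j\<close>.  Hence the \<open>N\<^sub>i\<close> can be chosen one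
  after the other in increasing order of \<open>key\<close>, each with \<open>h(N\<^sub>i)\<close> larger than a given multiple of
  all earlier \<open>N\<^sub>j\<close> (\<open>coprime_family_exists\<close>); this is possible because \<open>h\<close> is unbounded on the
  integers coprime to a given number, by divergence of the harmonic series.  By Markov's
  inequality, at least half of the \<open>t\<close> satisfy the upper bounds for all \<open>i\<close> at once, with a constant
  that depends on \<open>i\<close> only through \<open>N\<^sub>i\<close>, and for those \<open>t\<close> that are large enough the desired
  inequalities hold.

  The first statement ranks the forms by decreasing index.  The second takes the forms \<open>n + i\<close>, ranked
  by negated partial sums of the signs.  In the third, some of the forms \<open>a(n + j) + b\<close> and
  \<open>c(n + j') + d\<close> may be proportional; multiplying the former by \<open>c\<close> and the latter by \<open>a\<close> turns
  them into \<open>a c n + t\<close> with integers \<open>t\<close>, and \<open>t\<close> itself (or \<open>-t\<close>) can serve both as an index and as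
  a rank.  The factors are removed by \<open>\<sigma>(m) \<le> \<sigma>(a m)\<close> and \<open>\<sigma>(c m) \<le> \<sigma>(c) \<sigma>(m)\<close>.
\<close>

section \<open>The ratio of the divisor sum to its argument\<close>

text \<open>The abundancy index \<open>\<sigma>(m) / m\<close>; it takes the value \<open>0\<close> at \<open>m = 0\<close>.\<close>

definition abundancy :: "nat \<Rightarrow> real" where
  "abundancy m = real (divisor_sum m) / real m"

lemma divisor_sum_pos: "m > 0 \<Longrightarrow> divisor_sum m > 0"
  unfolding divisor_sum_def
  by (rule sum_pos) (auto intro: dvd_pos_nat)

lemma abundancy_eq_sum_inverse:
  assumes "m > 0"
  shows "abundancy m = (\<Sum>d | d dvd m. 1 / real d)"
proof -
  have "(\<Sum>d | d dvd m. real d / real m) = (\<Sum>d | d dvd m. 1 / real d)"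
    using assms
    by (intro sum.reindex_bij_witness[where i = "\<lambda>d. m div d" and j = "\<lambda>d. m div d"])
       (auto simp: dvd_div_eq_mult field_simps elim!: dvdE)
  thus ?thesis
    by (simp add: abundancy_def divisor_sum_def sum_divide_distrib)
qed

lemma abundancy_nonneg: "abundancy m \<ge> 0"
  by (simp add: abundancy_def)

lemma abundancy_mono_dvd:
  assumes "N dvd m" "m > 0"
  shows "abundancy N \<le> abundancy m"
proof -
  have "N > 0" using assms by (auto intro: dvd_pos_nat)
  thus ?thesis using assms
    by (auto simp: abundancy_eq_sum_inverse intro!: sum_mono2 intro: dvd_trans)
qed

lemma divisor_sum_mono_dvd:
  assumes "N dvd m" "m > 0"
  shows "divisor_sum N \<le> divisor_sum m"
  unfolding divisor_sum_def using assms
  by (intro sum_mono2) (auto intro: dvd_trans)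

lemma divisor_sum_mult_le:
  assumes "x > 0" "y > 0"
  shows "divisor_sum (x * y) \<le> divisor_sum x * divisor_sum y"
proof -
  have "{d. d dvd x * y} \<subseteq> (\<lambda>(u, v). u * v) ` ({u. u dvd x} \<times> {v. v dvd y})"
    by (force dest: division_decomp)
  hence "divisor_sum (x * y) \<le> (\<Sum>d \<in> (\<lambda>(u, v). u * v) ` ({u. u dvd x} \<times> {v. v dvd y}). d)"
    unfolding divisor_sum_def using assms by (intro sum_mono2) auto
  also have "\<dots> \<le> (\<Sum>p \<in> {u. u dvd x} \<times> {v. v dvd y}. case p of (u, v) \<Rightarrow> u * v)"
    using assms sum_image_le[of "{u. u dvd x} \<times> {v. v dvd y}" "\<lambda>d. d" "\<lambda>(u, v). u * v"]
    by (auto simp: o_def)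
  also have "\<dots> = divisor_sum x * divisor_sum y"
    by (simp add: divisor_sum_def sum_product sum.cartesian_product)
  finally show ?thesis .
qed

lemma abundancy_unbounded_coprime:
  fixes Q :: nat and X :: real
  assumes "Q > 0"
  obtains N where "N > 0" "coprime N Q" "abundancy N > X"
proof -
  have "filterlim (harm :: nat \<Rightarrow> real) at_top at_top"
    using harm_at_top by simp
  hence "eventually (\<lambda>n. harm n > real Q * X) at_top"
    by (simp add: filterlim_at_top_dense)
  then obtain n where n: "harm n > real Q * X"
    by (auto simp: eventually_at_top_linorder)
  \<comment> \<open>The factors \<open>j Q + 1\<close> are distinct divisors of \<open>N\<close>, all coprime to \<open>Q\<close>.\<close>
  define N where "N = (\<Prod>j<n. j * Q + 1)"
  have "N > 0" by (simp add: N_def)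
  moreover have "coprime N Q"
    unfolding N_def
  proof (rule prod_coprime_left)
    show "coprime (j * Q + 1) Q" for j
      using gcd_add_mult[of Q j 1] by (simp add: coprime_iff_gcd_eq_1 gcd.commute[of _ Q])
  qed
  moreover have "abundancy N > X"
  proof -
    have "X < harm n / real Q" using n assms by (simp add: field_simps)
    also have "\<dots> = (\<Sum>j<n. 1 / real (Suc j * Q))"
      by (simp add: harm_altdef sum_divide_distrib inverse_eq_divide del: of_nat_Suc mult_Suc)
    also have "\<dots> \<le> (\<Sum>j<n. 1 / real (j * Q + 1))"
      using assms by (intro sum_mono divide_left_mono) (auto simp flip: of_nat_add of_nat_mult of_nat_Suc)
    also have "\<dots> = (\<Sum>d \<in> (\<lambda>j. j * Q + 1) ` {..<n}. 1 / real d)"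
      using assms by (subst sum.reindex) (auto simp: inj_on_def)
    also have "\<dots> \<le> (\<Sum>d | d dvd N. 1 / real d)"
      using \<open>N > 0\<close> by (intro sum_mono2) (auto simp: N_def intro!: dvd_prodI)
    also have "\<dots> = abundancy N"
      using \<open>N > 0\<close> by (simp add: abundancy_eq_sum_inverse)
    finally show ?thesis .
  qed
  ultimately show ?thesis using that by blast
qed

text \<open>
  The induction adds indices in order of increasing \<open>key\<close>, so that only finitely many numbers,
  already chosen, have to be dominated by the abundancy of the new one.
\<close>

lemma coprime_family_exists:
  fixes key :: "'i \<Rightarrow> int" and D :: nat and B :: real
  assumes "finite I" "D > 0"
  shows "\<exists>N :: 'i \<Rightarrow> nat. (\<forall>i\<in>I. N i > 0 \<and> coprime (N i) D) \<and>
           (\<forall>i\<in>I. \<forall>j\<in>I. i \<noteq> j \<longrightarrow> coprime (N i) (N j)) \<and>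
           (\<forall>i\<in>I. \<forall>j\<in>I. key j < key i \<longrightarrow> abundancy (N i) > B * real (N j))"
  using assms(1)
proof (induction I rule: finite_ranking_induct[where f = key])
  case empty
  show ?case by simp
next
  case (insert x S)
  show ?case
  proof (cases "x \<in> S")
    case True
    thus ?thesis using insert.IH by (simp add: insert_absorb)
  next
    case False
    from insert.IH obtain N where N: "\<forall>i\<in>S. N i > 0 \<and> coprime (N i) D"
      "\<forall>i\<in>S. \<forall>j\<in>S. i \<noteq> j \<longrightarrow> coprime (N i) (N j)"
      "\<forall>i\<in>S. \<forall>j\<in>S. key j < key i \<longrightarrow> abundancy (N i) > B * real (N j)"
      by blast
    have "D * prod N S > 0" using N assms(2) by (auto intro!: prod_pos)
    then obtain m where m: "m > 0" "coprime m (D * prod N S)"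
      "abundancy m > \<bar>B\<bar> * (\<Sum>y\<in>S. real (N y))"
      using abundancy_unbounded_coprime by blast
    have m_D: "coprime m D" using m(2) by simp
    have m_N: "coprime m (N y)" if "y \<in> S" for y
      using m(2) coprime_divisors[OF dvd_refl, of "N y" "prod N S" m] that \<open>finite S\<close>
      by (simp add: dvd_prodI)
    have big: "abundancy m > B * real (N y)" if "y \<in> S" for y
    proof -
      have "B * real (N y) \<le> \<bar>B\<bar> * (\<Sum>y\<in>S. real (N y))"
        using that \<open>finite S\<close> by (intro mult_mono member_le_sum) auto
      thus ?thesis using m(3) by linarith
    qed
    have le: "key y \<le> key x" if "y \<in> S" for y using insert.hyps that by blast
    have ne: "y \<noteq> x" if "y \<in> S" for y using False that by blast
    define N' where "N' = N(x := m)"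
    have N'_x: "N' x = m" by (simp add: N'_def)
    have N'_S: "N' y = N y" if "y \<in> S" for y using ne[OF that] by (simp add: N'_def)
    have "N' i > 0 \<and> coprime (N' i) D" if "i \<in> insert x S" for i
      using that N(1) m(1) m_D N'_x N'_S by auto
    moreover have "coprime (N' i) (N' j)" if "i \<in> insert x S" "j \<in> insert x S" "i \<noteq> j" for i j
      using that N(2) m_N N'_x N'_S by (auto simp: coprime_commute)
    moreover have "abundancy (N' i) > B * real (N' j)"
      if "i \<in> insert x S" "j \<in> insert x S" "key j < key i" for i j
      using that N(3) big N'_x N'_S le by (metis insertE less_irrefl not_less)
    ultimately show ?thesis by (intro exI[of _ N'] conjI ballI impI) simp_all
  qed
qed

section \<open>Averages along arithmetic progressions\<close>

text \<open>
  If \<open>d\<close> divides some term of the progression, then \<open>e = gcd(d, \<beta>)\<close> divides \<open>\<alpha>\<close> as well, and the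
  solutions form a single residue class modulo \<open>d / e\<close>.
\<close>

lemma card_progression_dvd_le:
  fixes \<alpha> \<beta> :: int and d T :: nat
  assumes "\<beta> > 0" "d > 0"
  shows "real (card {t. t < T \<and> int d dvd \<alpha> + \<beta> * int t})
           \<le> real_of_int (gcd \<alpha> \<beta>) * (real T / real d + 1)"
proof (cases "{t. t < T \<and> int d dvd \<alpha> + \<beta> * int t} = {}")
  case True
  show ?thesis unfolding True by simp
next
  case False
  define S where "S = {t. t < T \<and> int d dvd \<alpha> + \<beta> * int t}"
  define e where "e = gcd (int d) \<beta>"
  have "e > 0" using assms by (simp add: e_def)
  obtain q' \<beta>' where q': "int d = q' * e" "\<beta> = \<beta>' * e" "coprime q' \<beta>'"
    using gcd_coprime_exists[of "int d" \<beta>] assms unfolding e_def by auto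
  have "q' > 0" using q'(1) assms(2) \<open>e > 0\<close>
    by (metis of_nat_0_less_iff zero_less_mult_pos2)
  then obtain q where q: "q' = int q" "q > 0"
    by (metis of_nat_0_less_iff zero_less_imp_eq_int)
  obtain t0 where t0: "t0 \<in> S" using False unfolding S_def by blast
  have "e dvd \<alpha> + \<beta> * int t0"
    using t0 unfolding S_def e_def by (auto intro: dvd_trans[OF gcd_dvd1])
  moreover have "e dvd \<beta> * int t0" unfolding e_def by simp
  ultimately have "e dvd \<alpha>" by (simp add: dvd_add_left_iff)
  hence "e dvd gcd \<alpha> \<beta>" unfolding e_def by simp
  moreover have g_pos: "gcd \<alpha> \<beta> > 0" using assms by simp
  ultimately have e_le: "e \<le> gcd \<alpha> \<beta>" by (rule zdvd_imp_le)
  have cong: "int q dvd int s - int t" if "s \<in> S" "t \<in> S" for s t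
  proof -
    have "int d dvd (\<alpha> + \<beta> * int s) - (\<alpha> + \<beta> * int t)"
      using that unfolding S_def by (intro dvd_diff) auto
    hence "q' * e dvd (\<beta>' * (int s - int t)) * e"
      using q' by (simp add: algebra_simps)
    hence "q' dvd \<beta>' * (int s - int t)" using \<open>e > 0\<close> by simp
    hence "q' dvd int s - int t" using q'(3) by (simp add: coprime_dvd_mult_right_iff)
    thus ?thesis using q by simp
  qed
  have "inj_on (\<lambda>t. t div q) S"
  proof (rule inj_onI)
    fix s t assume st: "s \<in> S" "t \<in> S" "s div q = t div q"
    have "[int s = int t] (mod int q)"
      using cong[OF st(1,2)] by (simp add: cong_iff_dvd_diff)
    hence "s mod q = t mod q"
      by (simp add: cong_int_iff) (simp add: cong_def)
    thus "s = t" using st(3) by (metis div_mult_mod_eq)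
  qed
  moreover have "(\<lambda>t. t div q) ` S \<subseteq> {..T div q}"
    by (auto simp: S_def intro!: div_le_mono)
  ultimately have "card S \<le> card {..T div q}"
    by (metis card_inj_on_le finite_atMost)
  hence "real (card S) \<le> real (T div q) + 1" by simp
  also have "\<dots> \<le> real T / real q + 1"
    by (simp add: of_nat_div_le_of_nat)
  also have "real T / real q = real_of_int e * (real T / real d)"
  proof -
    have "real d = real q * real_of_int e"
      using q'(1) q(1) by (metis of_int_mult of_int_of_nat_eq)
    thus ?thesis using \<open>e > 0\<close> by simp
  qed
  also have "real_of_int e * (real T / real d) + 1
               \<le> real_of_int (gcd \<alpha> \<beta>) * (real T / real d) + real_of_int (gcd \<alpha> \<beta>)"
  proof -
    have "real_of_int e \<le> real_of_int (gcd \<alpha> \<beta>)" using e_le by (subst of_int_le_iff)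
    moreover have "1 \<le> real_of_int (gcd \<alpha> \<beta>)" using g_pos by linarith
    ultimately show ?thesis by (intro add_mono mult_right_mono) auto
  qed
  finally show ?thesis by (simp add: S_def algebra_simps)
qed

lemma sum_inverse_squares_le: "(\<Sum>d=1..n. 1 / (real d)\<^sup>2) \<le> 2"
proof -
  have "(\<Sum>d=1..Suc n. 1 / (real d)\<^sup>2) \<le> 2 - 1 / real (Suc n)" for n
  proof (induction n)
    case (Suc n)
    have "1 / (real (Suc (Suc n)))\<^sup>2 \<le> 1 / real (Suc n) - 1 / real (Suc (Suc n))"
      by (simp add: divide_simps power2_eq_square)
    thus ?case using Suc.IH by simp
  qed simp
  from this[of n] have "(\<Sum>d=1..Suc n. 1 / (real d)\<^sup>2) \<le> 2"
    by (rule order_trans) simp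
  moreover have "(\<Sum>d=1..n. 1 / (real d)\<^sup>2) \<le> (\<Sum>d=1..Suc n. 1 / (real d)\<^sup>2)"
    by (rule sum_mono2) auto
  ultimately show ?thesis by linarith
qed

text \<open>A crude bound in place of the logarithmic one: only linear growth in \<open>T\<close> matters below.\<close>

lemma sum_inverse_upto_square_le:
  assumes "T > 0"
  shows "(\<Sum>d=1..T\<^sup>2. 1 / real d) \<le> 2 * real T"
proof -
  have "(\<Sum>d=1..T\<^sup>2. 1 / real d) \<le> (\<Sum>d=1..T\<^sup>2. 1 / real T + (if d \<le> T then 1 else 0))"
  proof (rule sum_mono)
    fix d assume "d \<in> {1..T\<^sup>2}"
    hence "1 / real d \<le> 1" "d > T \<Longrightarrow> 1 / real d \<le> 1 / real T" "1 / real T \<ge> 0"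
      using assms by (auto simp: frac_le)
    thus "1 / real d \<le> 1 / real T + (if d \<le> T then 1 else 0)"
      by (smt (verit) not_le)
  qed
  also have "\<dots> = real T + real (card {d \<in> {1..T\<^sup>2}. d \<le> T})"
    using assms sum.inter_filter[of "{1..T\<^sup>2}" "\<lambda>_. 1 :: real" "\<lambda>d. d \<le> T"]
    by (simp add: sum.distrib power2_eq_square)
  also have "card {d \<in> {1..T\<^sup>2}. d \<le> T} \<le> card {1..T}"
    by (rule card_mono) auto
  finally show ?thesis by simp
qed

text \<open>
  The assumption on \<open>T\<close> ensures that the terms of the progression, hence their divisors, are at
  most \<open>T\<^sup>2\<close>.  Nonpositive terms are sent to \<open>0\<close> by \<^const>\<open>nat\<close> and contribute nothing.
\<close>

lemma sum_abundancy_progression_le: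
  fixes \<alpha> \<beta> :: int and T :: nat
  assumes "\<beta> > 0" "int T \<ge> \<bar>\<alpha>\<bar> + \<beta>"
  shows "(\<Sum>t<T. abundancy (nat (\<alpha> + \<beta> * int t))) \<le> 4 * real_of_int (gcd \<alpha> \<beta>) * real T"
proof -
  define g where "g = real_of_int (gcd \<alpha> \<beta>)"
  have "g \<ge> 0" by (simp add: g_def)
  have "T > 0" using assms by linarith
  have pt: "abundancy (nat (\<alpha> + \<beta> * int t))
              \<le> (\<Sum>d=1..T\<^sup>2. if int d dvd \<alpha> + \<beta> * int t then 1 / real d else 0)"
    if "t < T" for t
  proof (cases "\<alpha> + \<beta> * int t > 0")
    case True
    define m where "m = nat (\<alpha> + \<beta> * int t)"
    have m: "m > 0" "int m = \<alpha> + \<beta> * int t" using True by (auto simp: m_def)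
    have "int m \<le> int (T\<^sup>2)"
    proof -
      have "\<alpha> + \<beta> * int t \<le> \<bar>\<alpha>\<bar> * int T + \<beta> * int T"
        using that assms(1) \<open>T > 0\<close> mult_left_mono[of 1 "int T" "\<bar>\<alpha>\<bar>"] by (intro add_mono mult_left_mono) auto
      also have "\<dots> = (\<bar>\<alpha>\<bar> + \<beta>) * int T" by (simp add: algebra_simps)
      also have "\<dots> \<le> int T * int T" using assms(2) by (intro mult_right_mono) auto
      finally show ?thesis using m by (simp add: power2_eq_square)
    qed
    hence "m \<le> T\<^sup>2" by linarith
    have "abundancy m = (\<Sum>d | d dvd m. 1 / real d)"
      using m by (simp add: abundancy_eq_sum_inverse)
    also have "{d. d dvd m} = {d \<in> {1..T\<^sup>2}. int d dvd \<alpha> + \<beta> * int t}"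
      using m(1) \<open>m \<le> T\<^sup>2\<close> dvd_imp_le[of _ m] unfolding m(2)[symmetric]
      by (auto simp: Suc_le_eq intro: dvd_pos_nat order_trans)
    also have "(\<Sum>d\<in>\<dots>. 1 / real d)
        = (\<Sum>d=1..T\<^sup>2. if int d dvd \<alpha> + \<beta> * int t then 1 / real d else 0)"
      by (rule sum.inter_filter) simp
    finally show ?thesis by (simp add: m_def)
  next
    case False
    hence "abundancy (nat (\<alpha> + \<beta> * int t)) = 0" by (simp add: abundancy_def)
    thus ?thesis by (simp add: sum_nonneg)
  qed
  have "(\<Sum>t<T. abundancy (nat (\<alpha> + \<beta> * int t)))
      \<le> (\<Sum>t<T. \<Sum>d=1..T\<^sup>2. if int d dvd \<alpha> + \<beta> * int t then 1 / real d else 0)"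
    using pt by (intro sum_mono) auto
  also have "\<dots> = (\<Sum>d=1..T\<^sup>2. \<Sum>t<T. if int d dvd \<alpha> + \<beta> * int t then 1 / real d else 0)"
    by (rule sum.swap)
  also have "\<dots> = (\<Sum>d=1..T\<^sup>2. 1 / real d * real (card {t. t < T \<and> int d dvd \<alpha> + \<beta> * int t}))"
  proof (rule sum.cong[OF refl])
    fix d
    have "(\<Sum>t<T. if int d dvd \<alpha> + \<beta> * int t then 1 / real d else 0)
        = (\<Sum>t \<in> {t \<in> {..<T}. int d dvd \<alpha> + \<beta> * int t}. 1 / real d)"
      by (rule sum.inter_filter[symmetric]) simp
    thus "(\<Sum>t<T. if int d dvd \<alpha> + \<beta> * int t then 1 / real d else 0)
        = 1 / real d * real (card {t. t < T \<and> int d dvd \<alpha> + \<beta> * int t})"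
      by simp
  qed
  also have "\<dots> \<le> (\<Sum>d=1..T\<^sup>2. 1 / real d * (g * (real T / real d + 1)))"
    unfolding g_def using assms(1)
    by (intro sum_mono mult_left_mono card_progression_dvd_le) auto
  also have "\<dots> = g * (real T * (\<Sum>d=1..T\<^sup>2. 1 / (real d)\<^sup>2) + (\<Sum>d=1..T\<^sup>2. 1 / real d))"
    by (simp add: sum_distrib_left sum.distrib[symmetric] algebra_simps power2_eq_square)
  also have "\<dots> \<le> g * (real T * 2 + 2 * real T)"
    using \<open>g \<ge> 0\<close> \<open>T > 0\<close>
    by (intro mult_left_mono add_mono sum_inverse_squares_le sum_inverse_upto_square_le) auto
  finally show ?thesis by (simp add: g_def)
qed

text \<open>Markov's inequality for the counting measure on an initial segment.\<close>

lemma card_large_le: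
  fixes f :: "nat \<Rightarrow> real"
  assumes "K > 0" "\<And>t. f t \<ge> 0" "(\<Sum>t<T. f t) \<le> c * K"
  shows "real (card {t. t < T \<and> f t > K}) \<le> c"
proof -
  have "real (card {t. t < T \<and> f t > K}) * K = (\<Sum>t | t < T \<and> f t > K. K)" by simp
  also have "\<dots> \<le> (\<Sum>t | t < T \<and> f t > K. f t)" by (intro sum_mono) auto
  also have "\<dots> \<le> (\<Sum>t<T. f t)" using assms by (intro sum_mono2) auto
  also have "\<dots> \<le> c * K" by fact
  finally show ?thesis using assms(1) by simp
qed

section \<open>Lower density\<close>

lemma finite_initial_segment: "finite {n \<in> S. real n \<le> x}"
proof (rule finite_subset)
  show "{n \<in> S. real n \<le> x} \<subseteq> {..nat \<lfloor>x\<rfloor>}" by (auto simp: le_nat_floor)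
qed simp

lemma lower_density_mono:
  assumes "S \<subseteq> S'"
  shows "lower_density S \<le> lower_density S'"
  unfolding lower_density_def
proof (rule Liminf_mono)
  show "\<forall>\<^sub>F x in at_top. ereal (real (card {n \<in> S. real n \<le> x}) / x)
          \<le> ereal (real (card {n \<in> S'. real n \<le> x}) / x)"
    using eventually_gt_at_top[of 0]
  proof eventually_elim
    case (elim x)
    have "card {n \<in> S. real n \<le> x} \<le> card {n \<in> S'. real n \<le> x}"
      using assms by (intro card_mono finite_initial_segment) auto
    thus ?case using elim by (simp add: divide_right_mono)
  qed
qed

lemma lower_density_pos_progression:
  fixes S :: "nat set" and r M T0 :: nat
  assumes "M > 0" "\<And>T. T \<ge> T0 \<Longrightarrow> real (card {t. t < T \<and> r + M * t \<in> S}) \<ge> real T / 4"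
  shows "lower_density S > 0"
proof -
  \<comment> \<open>Up to \<open>x\<close> the progression has about \<open>x / M\<close> terms; halving the bound \<open>x / (4 M)\<close> absorbs the
    shift by \<open>r\<close> and the rounding.\<close>
  define c where "c = 1 / (8 * real M)"
  have "c > 0" using assms(1) by (simp add: c_def)
  have "ereal c \<le> lower_density S"
    unfolding lower_density_def
  proof (rule Liminf_bounded)
    show "\<forall>\<^sub>F x in at_top. ereal c \<le> ereal (real (card {n \<in> S. real n \<le> x}) / x)"
      using eventually_ge_at_top[of "real (r + M * T0) + 1"]
        eventually_ge_at_top[of "2 * (real r + real M)"]
    proof eventually_elim
      case (elim x)
      define T where "T = nat \<lfloor>(x - real r) / real M\<rfloor>"
      have "x > 0" using elim(1) by (smt (verit) of_nat_0_le_iff)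
      have q0: "(x - real r) / real M \<ge> real T0"
        using elim(1) assms(1) by (simp add: field_simps)
      hence "T \<ge> T0" unfolding T_def by (simp add: le_nat_floor)
      have T_le: "real T \<le> (x - real r) / real M"
        unfolding T_def using q0 by (smt (verit) of_nat_0_le_iff of_nat_floor)
      have T_ge: "real T \<ge> (x - real r) / real M - 1"
        unfolding T_def by linarith
      have "(x - real r) / real M - 1 \<ge> x / (2 * real M)"
        using elim(2) assms(1) by (simp add: field_simps)
      hence "c * x \<le> real T / 4" using T_ge by (simp add: c_def)
      also have "\<dots> \<le> real (card {t. t < T \<and> r + M * t \<in> S})"
        using assms(2) \<open>T \<ge> T0\<close> by blast
      also have "card {t. t < T \<and> r + M * t \<in> S}
                   = card ((\<lambda>t. r + M * t) ` {t. t < T \<and> r + M * t \<in> S})"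
        using assms(1) by (subst card_image) (auto simp: inj_on_def)
      also have "\<dots> \<le> card {n \<in> S. real n \<le> x}"
      proof (intro card_mono finite_initial_segment, clarify)
        fix t assume t: "t < T"
        have "real M * real t \<le> real M * real T"
          using t by (intro mult_left_mono) auto
        also have "\<dots> \<le> x - real r" using T_le assms(1) by (simp add: field_simps)
        finally show "real (r + M * t) \<le> x" by simp
      qed
      finally have "c * x \<le> real (card {n \<in> S. real n \<le> x})" by simp
      thus ?case using \<open>x > 0\<close> by (simp add: field_simps)
    qed
  qed
  thus ?thesis using \<open>c > 0\<close> by (metis ereal_less(2) less_le_trans)
qed

section \<open>Prescribing the order of the divisor sums of linear forms\<close>

text \<open>
  Here \<open>L\<close> and \<open>L'\<close> are the values at \<open>n\<close> of two of the linear forms, \<open>A\<close> bounds the coefficients,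
  and \<open>Nj\<close> is the divisor imposed on \<open>L'\<close>.
\<close>

lemma ordered_divisor_sums_step:
  fixes L L' n Nj :: nat and A C c :: real
  assumes "real n \<le> 2 * real L" "real L' \<le> 2 * A * real n" "n > 0"
    and "abundancy L > 4 * C * c * A\<^sup>2 * real Nj" "abundancy L' \<le> c * A * real Nj"
    and "C > 0" "c > 0" "A > 0"
  shows "real (divisor_sum L) > C * real (divisor_sum L')"
proof -
  have "L > 0" using assms(1,3) by (cases "L = 0") auto
  have "C * real (divisor_sum L') = C * (real L' * abundancy L')"
    by (cases "L' = 0") (simp_all add: abundancy_def divisor_sum_def)
  also have "\<dots> \<le> C * ((2 * A * real n) * (c * A * real Nj))"
    using assms abundancy_nonneg[of L'] by (intro mult_left_mono mult_mono) auto
  also have "\<dots> = real n / 2 * (4 * C * c * A\<^sup>2 * real Nj)"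
    by (simp add: power2_eq_square)
  also have "\<dots> \<le> real L * (4 * C * c * A\<^sup>2 * real Nj)"
    using assms by (intro mult_right_mono) auto
  also have "\<dots> < real L * abundancy L"
    using assms(4) \<open>L > 0\<close> by (intro mult_strict_left_mono) auto
  also have "\<dots> = real (divisor_sum L)"
    using \<open>L > 0\<close> by (simp add: abundancy_def)
  finally show ?thesis .
qed

lemma linear_forms_simultaneous_root:
  fixes a b :: "'i \<Rightarrow> int" and N :: "'i \<Rightarrow> nat"
  assumes "finite I" "\<And>i. i \<in> I \<Longrightarrow> N i > 0" "\<And>i. i \<in> I \<Longrightarrow> coprime (a i) (int (N i))"
    and "\<And>i j. i \<in> I \<Longrightarrow> j \<in> I \<Longrightarrow> i \<noteq> j \<Longrightarrow> coprime (N i) (N j)"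
  obtains r :: nat where "\<And>i. i \<in> I \<Longrightarrow> int (N i) dvd a i * int r + b i"
proof -
  have "\<exists>u :: nat. [a i * int u + b i = 0] (mod int (N i))" if i: "i \<in> I" for i
  proof -
    obtain x where x: "[a i * x = 1] (mod int (N i))"
      using cong_solve_coprime_int assms(3)[OF i] by blast
    define u where "u = nat ((- b i * x) mod int (N i))"
    have u: "[int u = - b i * x] (mod int (N i))"
      using assms(2)[OF i] by (simp add: u_def)
    have "[a i * int u + b i = a i * (- b i * x) + b i] (mod int (N i))"
      by (intro cong_add cong_mult u cong_refl)
    also have "a i * (- b i * x) + b i = - b i * (a i * x) + b i" by (simp add: algebra_simps)
    also have "[\<dots> = - b i * 1 + b i] (mod int (N i))"
      by (intro cong_add cong_mult x cong_refl)
    finally show ?thesis by auto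
  qed
  then obtain u :: "'i \<Rightarrow> nat" where u: "\<And>i. i \<in> I \<Longrightarrow> [a i * int (u i) + b i = 0] (mod int (N i))"
    by metis
  have "\<exists>r. \<forall>i\<in>I. [r = u i] (mod N i)"
    using assms(1,4) by (intro chinese_remainder_nat) auto
  then obtain r where r: "\<And>i. i \<in> I \<Longrightarrow> [r = u i] (mod N i)" by blast
  have "int (N i) dvd a i * int r + b i" if i: "i \<in> I" for i
  proof -
    have "[int r = int (u i)] (mod int (N i))" using r[OF i] by (simp add: cong_int_iff)
    hence "[a i * int r + b i = a i * int (u i) + b i] (mod int (N i))"
      by (intro cong_add cong_mult cong_refl)
    hence "[a i * int r + b i = 0] (mod int (N i))" using u[OF i] by (rule cong_trans)
    thus ?thesis by (simp add: cong_0_iff)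
  qed
  thus ?thesis using that by blast
qed

text \<open>
  The ranking \<open>key\<close> need not be injective: nothing is claimed about forms of equal rank.
\<close>

lemma lower_density_ordered_divisor_sums:
  fixes a b key :: "'i \<Rightarrow> int" and C :: real
  assumes fin: "finite I" and a_pos: "\<And>i. i \<in> I \<Longrightarrow> a i > 0"
    and indep: "\<And>i j. i \<in> I \<Longrightarrow> j \<in> I \<Longrightarrow> i \<noteq> j \<Longrightarrow> a i * b j \<noteq> a j * b i"
    and "C > 0"
  shows "lower_density {n. n > 0 \<and> (\<forall>i\<in>I. a i * int n + b i > 0) \<and>
           (\<forall>i\<in>I. \<forall>j\<in>I. key j < key i \<longrightarrow>
              real (divisor_sum (nat (a i * int n + b i)))
                > C * real (divisor_sum (nat (a j * int n + b j))))} > 0"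
    (is "lower_density ?S > 0")
proof -
  define A where "A = 1 + (\<Sum>i\<in>I. nat (a i))"
  have A: "a i \<le> int A" if "i \<in> I" for i
  proof -
    have "nat (a i) \<le> A"
      unfolding A_def using that fin by (intro trans_le_add2 member_le_sum) auto
    thus ?thesis by linarith
  qed
  have "A > 0" by (simp add: A_def)
  \<comment> \<open>With this factor, Markov's inequality discards a proportion of at most
    \<open>1 / (2 (card I + 1))\<close> for each form, hence less than one half in total.\<close>
  define c where "c = 8 * (real (card I) + 1)"
  have "c > 0" by (simp add: c_def)
  define D where "D = (\<Prod>i\<in>I. nat (a i)) * (\<Prod>i\<in>I. \<Prod>j\<in>I-{i}. nat \<bar>a i * b j - a j * b i\<bar>)"
  have "D > 0"
  proof -
    have "nat \<bar>a i * b j - a j * b i\<bar> > 0" if "i \<in> I" "j \<in> I - {i}" for i j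
      using indep[of i j] that by auto
    thus ?thesis unfolding D_def using a_pos by (intro mult_pos_pos prod_pos) auto
  qed
  have a_dvd_D: "a i dvd int D" if "i \<in> I" for i
  proof -
    have "nat (a i) dvd D"
      unfolding D_def using fin that by (intro dvd_mult2 dvd_prodI)
    thus ?thesis using a_pos[OF that] by (simp add: int_dvd_int_iff[symmetric])
  qed
  have det_dvd_D: "a i * b j - a j * b i dvd int D" if "i \<in> I" "j \<in> I" "i \<noteq> j" for i j
  proof -
    have "nat \<bar>a i * b j - a j * b i\<bar> dvd (\<Prod>j\<in>I-{i}. nat \<bar>a i * b j - a j * b i\<bar>)"
      using fin that by (intro dvd_prodI) auto
    also have "\<dots> dvd D"
      unfolding D_def using fin that
      by (intro dvd_mult dvd_prodI[where f = "\<lambda>i. \<Prod>j\<in>I-{i}. nat \<bar>a i * b j - a j * b i\<bar>"])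
    finally show ?thesis by (simp add: int_dvd_int_iff[symmetric])
  qed
  define B where "B = 4 * C * c * (real A)\<^sup>2"
  obtain N :: "'i \<Rightarrow> nat" where N: "\<forall>i\<in>I. N i > 0 \<and> coprime (N i) D"
    "\<forall>i\<in>I. \<forall>j\<in>I. i \<noteq> j \<longrightarrow> coprime (N i) (N j)"
    "\<forall>i\<in>I. \<forall>j\<in>I. key j < key i \<longrightarrow> abundancy (N i) > B * real (N j)"
    using coprime_family_exists[OF fin \<open>D > 0\<close>, of key B] by blast
  have N_D: "coprime (int (N i)) (int D)" if "i \<in> I" for i using N(1) that by simp
  obtain r :: nat where r: "\<And>i. i \<in> I \<Longrightarrow> int (N i) dvd a i * int r + b i"
  proof (rule linear_forms_simultaneous_root[OF fin, of N a b])
    show "coprime (a i) (int (N i))" if "i \<in> I" for i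
      by (rule coprime_divisors[OF a_dvd_D[OF that] dvd_refl])
         (use N_D[OF that] in \<open>simp only: coprime_commute\<close>)
  qed (use N in auto)
  define M where "M = prod N I"
  have "M > 0" using N(1) by (auto simp: M_def intro!: prod_pos)
  define \<alpha> \<beta> where "\<alpha> i = a i * int r + b i" and "\<beta> i = a i * int M" for i
  have \<beta>_pos: "\<beta> i > 0" if "i \<in> I" for i
    using a_pos[OF that] \<open>M > 0\<close> by (simp add: \<beta>_def)
  have form: "a i * int (r + M * t) + b i = \<alpha> i + \<beta> i * int t" for i t
    by (simp add: \<alpha>_def \<beta>_def algebra_simps)
  have coprime_\<alpha>: "coprime (\<alpha> i) (int (N j))" if ij: "i \<in> I" "j \<in> I" "i \<noteq> j" for i j
  proof (rule coprimeI)
    fix p assume p: "p dvd \<alpha> i" "p dvd int (N j)"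
    have "p dvd \<alpha> j" using p(2) r[OF ij(2)] by (auto simp: \<alpha>_def intro: dvd_trans)
    hence "p dvd a i * \<alpha> j - a j * \<alpha> i" using p(1) by simp
    also have "\<dots> = a i * b j - a j * b i" by (simp add: \<alpha>_def algebra_simps)
    also have "\<dots> dvd int D" using det_dvd_D ij by blast
    finally show "is_unit p" using p(2) N_D[OF ij(2)] coprime_common_divisor by blast
  qed
  have gcd_le: "gcd (\<alpha> i) (\<beta> i) \<le> int A * int (N i)" if i: "i \<in> I" for i
  proof -
    define M' where "M' = prod N (I - {i})"
    have "M = N i * M'" using fin i by (simp add: M_def M'_def prod.remove)
    hence \<beta>: "\<beta> i = (a i * int (N i)) * int M'" by (simp add: \<beta>_def)
    have "coprime (\<alpha> i) (int M')"
      unfolding M'_def of_nat_prod using coprime_\<alpha> i by (intro prod_coprime_right) auto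
    hence "coprime (gcd (\<alpha> i) (\<beta> i)) (int M')"
      by (rule coprime_divisors[OF gcd_dvd1 dvd_refl])
    moreover have "gcd (\<alpha> i) (\<beta> i) dvd (a i * int (N i)) * int M'"
      unfolding \<beta>[symmetric] by simp
    ultimately have "gcd (\<alpha> i) (\<beta> i) dvd a i * int (N i)"
      by (simp add: coprime_dvd_mult_left_iff)
    hence "gcd (\<alpha> i) (\<beta> i) \<le> a i * int (N i)"
      using a_pos[OF i] N(1) i by (intro zdvd_imp_le) auto
    also have "\<dots> \<le> int A * int (N i)" using A[OF i] by (intro mult_right_mono) auto
    finally show ?thesis .
  qed
  \<comment> \<open>The parameters at which the value of the \<open>i\<close>-th form has too large an abundancy\<close>
  define bad where "bad i T = {t. t < T \<and> abundancy (nat (\<alpha> i + \<beta> i * int t)) > c * real A * real (N i)}"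
    for i T
  have bad_le: "real (card (bad i T)) \<le> real T / (2 * (real (card I) + 1))"
    if i: "i \<in> I" and T: "int T \<ge> \<bar>\<alpha> i\<bar> + \<beta> i" for i T
    unfolding bad_def
  proof (rule card_large_le)
    show "c * real A * real (N i) > 0" using \<open>c > 0\<close> \<open>A > 0\<close> N(1) i by simp
    have "real_of_int (gcd (\<alpha> i) (\<beta> i)) \<le> real_of_int (int A * int (N i))"
      using gcd_le[OF i] by (subst of_int_le_iff)
    hence g: "real_of_int (gcd (\<alpha> i) (\<beta> i)) \<le> real A * real (N i)" by simp
    have "(\<Sum>t<T. abundancy (nat (\<alpha> i + \<beta> i * int t))) \<le> 4 * real_of_int (gcd (\<alpha> i) (\<beta> i)) * real T"
      by (rule sum_abundancy_progression_le[OF \<beta>_pos[OF i] T])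
    also have "\<dots> \<le> 4 * (real A * real (N i)) * real T"
      using g by (intro mult_right_mono mult_left_mono) auto
    also have "\<dots> = real T / (2 * (real (card I) + 1)) * (c * real A * real (N i))"
      by (simp add: c_def divide_simps)
    finally show "(\<Sum>t<T. abundancy (nat (\<alpha> i + \<beta> i * int t))) \<le> \<dots>" .
  qed (rule abundancy_nonneg)
  \<comment> \<open>From \<open>n0\<close> on, each form lies between \<open>n / 2\<close> and \<open>2 A n\<close>.\<close>
  define n0 where "n0 = 1 + 2 * (\<Sum>i\<in>I. nat \<bar>b i\<bar>)"
  have n0: "2 * \<bar>b i\<bar> < int n0" if "i \<in> I" for i
  proof -
    have "nat \<bar>b i\<bar> \<le> (\<Sum>i\<in>I. nat \<bar>b i\<bar>)" using that fin by (intro member_le_sum) auto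
    thus ?thesis unfolding n0_def by linarith
  qed
  have good: "r + M * t \<in> ?S" if t: "t < T" "n0 \<le> t" "\<And>i. i \<in> I \<Longrightarrow> t \<notin> bad i T" for t T
  proof -
    define n where "n = r + M * t"
    define L where "L i = nat (a i * int n + b i)" for i
    have "t \<le> M * t" using \<open>M > 0\<close> by simp
    hence "n \<ge> n0" using t(2) unfolding n_def by linarith
    have "n > 0" using \<open>n \<ge> n0\<close> by (simp add: n0_def)
    have form_ge: "int n \<le> 2 * (a i * int n + b i)" if i: "i \<in> I" for i
    proof -
      have "1 * int n \<le> a i * int n" using a_pos[OF i] by (intro mult_right_mono) auto
      moreover have "2 * \<bar>b i\<bar> < int n" using n0[OF i] \<open>n \<ge> n0\<close> by linarith
      ultimately show ?thesis by (simp add: distrib_left)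
    qed
    have form_le: "a i * int n + b i \<le> 2 * int A * int n" if i: "i \<in> I" for i
    proof -
      have "a i * int n \<le> int A * int n" using A[OF i] by (intro mult_right_mono) auto
      moreover have "1 * int n \<le> int A * int n" using \<open>A > 0\<close> by (intro mult_right_mono) auto
      moreover have "2 * \<bar>b i\<bar> < int n" using n0[OF i] \<open>n \<ge> n0\<close> by linarith
      ultimately show ?thesis by simp
    qed
    have pos: "a i * int n + b i > 0" if "i \<in> I" for i
    proof -
      have "0 < 2 * (a i * int n + b i)"
        by (rule less_le_trans[OF _ form_ge[OF that]]) (use \<open>n > 0\<close> in simp)
      thus ?thesis by (rule zero_less_mult_pos) simp
    qed
    have L_int: "int (L i) = a i * int n + b i" if "i \<in> I" for i
      using pos[OF that] by (simp add: L_def)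
    have "real (divisor_sum (L i)) > C * real (divisor_sum (L j))"
      if ij: "i \<in> I" "j \<in> I" "key j < key i" for i j
    proof (rule ordered_divisor_sums_step)
      have "int n \<le> int (2 * L i)" using form_ge[OF ij(1)] L_int[OF ij(1)] by simp
      hence "real n \<le> real (2 * L i)" by (simp only: of_nat_le_iff)
      thus "real n \<le> 2 * real (L i)" by simp
      have "int (L j) \<le> int (2 * A * n)" using form_le[OF ij(2)] L_int[OF ij(2)] by simp
      hence "real (L j) \<le> real (2 * A * n)" by (simp only: of_nat_le_iff)
      thus "real (L j) \<le> 2 * real A * real n" by simp
      have "int (N i) dvd int (L i)"
        unfolding L_int[OF ij(1)] n_def form
      proof (rule dvd_add)
        show "int (N i) dvd \<alpha> i" using r[OF ij(1)] by (simp add: \<alpha>_def)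
        have "N i dvd M" unfolding M_def using fin ij(1) by (rule dvd_prodI)
        thus "int (N i) dvd \<beta> i * int t" by (simp add: \<beta>_def dvd_mult dvd_mult2)
      qed
      hence "N i dvd L i" by (simp only: int_dvd_int_iff)
      hence "abundancy (N i) \<le> abundancy (L i)"
        using pos[OF ij(1)] by (intro abundancy_mono_dvd) (auto simp: L_def)
      moreover have "abundancy (N i) > B * real (N j)" using N(3) ij by blast
      ultimately show "abundancy (L i) > 4 * C * c * (real A)\<^sup>2 * real (N j)"
        by (simp add: B_def)
      show "abundancy (L j) \<le> c * real A * real (N j)"
        using t(3)[OF ij(2)] t(1) unfolding bad_def form[symmetric] L_def n_def by simp
    qed (use \<open>n > 0\<close> \<open>C > 0\<close> \<open>c > 0\<close> \<open>A > 0\<close> in auto)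
    thus ?thesis using \<open>n > 0\<close> pos unfolding L_def n_def by blast
  qed
  define T0 where "T0 = 4 * n0 + (\<Sum>i\<in>I. nat (\<bar>\<alpha> i\<bar> + \<beta> i))"
  show ?thesis
  proof (rule lower_density_pos_progression[OF \<open>M > 0\<close>, where ?T0.0 = T0 and r = r])
    fix T assume T: "T \<ge> T0"
    define G where "G = {t. t < T \<and> r + M * t \<in> ?S}"
    have bad: "real (card (bad i T)) \<le> real T / (2 * (real (card I) + 1))" if i: "i \<in> I" for i
    proof (rule bad_le[OF i])
      have "nat (\<bar>\<alpha> i\<bar> + \<beta> i) \<le> (\<Sum>i\<in>I. nat (\<bar>\<alpha> i\<bar> + \<beta> i))"
        using i fin by (intro member_le_sum) auto
      thus "int T \<ge> \<bar>\<alpha> i\<bar> + \<beta> i" using T unfolding T0_def by linarith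
    qed
    have "{..<T} \<subseteq> G \<union> {..<n0} \<union> (\<Union>i\<in>I. bad i T)"
      using good unfolding G_def by fastforce
    hence "card {..<T} \<le> card (G \<union> {..<n0} \<union> (\<Union>i\<in>I. bad i T))"
      using fin by (intro card_mono) (auto simp: G_def bad_def)
    also have "\<dots> \<le> card (G \<union> {..<n0}) + card (\<Union>i\<in>I. bad i T)"
      by (rule card_Un_le)
    also have "\<dots> \<le> card G + card {..<n0} + (\<Sum>i\<in>I. card (bad i T))"
      using fin by (intro add_mono card_Un_le card_UN_le)
    finally have "T \<le> card G + n0 + (\<Sum>i\<in>I. card (bad i T))" by simp
    hence "real T \<le> real (card G + n0 + (\<Sum>i\<in>I. card (bad i T)))" by (simp only: of_nat_le_iff)
    hence "real T \<le> real (card G) + real n0 + (\<Sum>i\<in>I. real (card (bad i T)))" by simp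
    also have "(\<Sum>i\<in>I. real (card (bad i T))) \<le> (\<Sum>i\<in>I. real T / (2 * (real (card I) + 1)))"
      by (intro sum_mono bad)
    also have "\<dots> \<le> real T / 2" by (simp add: divide_simps) (simp add: algebra_simps)
    finally have "real T / 2 \<le> real (card G) + real n0" by simp
    moreover have "4 * real n0 \<le> real T" using T unfolding T0_def by linarith
    ultimately show "real T / 4 \<le> real (card {t. t < T \<and> r + M * t \<in> ?S})"
      unfolding G_def by linarith
  qed
qed

section \<open>Chains of inequalities between divisor sums\<close>

theorem corollary4:
  shows
   "(\<forall>(k::nat) (a :: nat \<Rightarrow> int) (b :: nat \<Rightarrow> int).
       k \<ge> 2 \<and> (\<forall>i\<in>{1..k}. a i > 0) \<and>
       (\<forall>i j. 1 \<le> i \<and> i < j \<and> j \<le> k \<longrightarrow> a i * b j \<noteq> a j * b i) \<longrightarrow>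
       (\<forall>C::real. C > 0 \<longrightarrow>
          lower_density {n::nat. n > 0 \<and> (\<forall>i\<in>{1..k}. a i * int n + b i > 0) \<and>
            (\<forall>i\<in>{1..<k}. real (divisor_sum (nat (a i * int n + b i))) /
                 real (divisor_sum (nat (a (i+1) * int n + b (i+1)))) > C)} > 0) \<and>
       lower_density {n::nat. n > 0 \<and> (\<forall>i\<in>{1..k}. a i * int n + b i > 0) \<and>
         (\<forall>i\<in>{1..<k}. divisor_sum (nat (a i * int n + b i)) >
              divisor_sum (nat (a (i+1) * int n + b (i+1))))} > 0)
    \<and>
    (\<forall>(k::nat) (\<epsilon> :: nat \<Rightarrow> int).
       k \<ge> 2 \<and> (\<forall>i\<in>{1..<k}. \<epsilon> i \<in> {-1, 1}) \<longrightarrow>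
       lower_density {n::nat. n > 0 \<and>
         (\<forall>i\<in>{1..<k}. \<epsilon> i * (int (divisor_sum (n + i)) - int (divisor_sum (n + (i+1)))) > 0)} > 0)
    \<and>
    (\<forall>(a::int) (b::int) (c::int) (d::int) (k::nat).
       a > 0 \<and> c > 0 \<and> a * d \<noteq> b * c \<and> k > 0 \<longrightarrow>
       lower_density {n::nat. n > 0 \<and>
         (\<forall>j\<in>{1..k}. a * int (n + j) + b > 0 \<and> c * int (n + j) + d > 0) \<and>
         (\<forall>j\<in>{1..k}. divisor_sum (nat (a * int (n + j) + b)) >
              divisor_sum (nat (c * int (n + j) + d)))} > 0)"
proof (intro conjI allI impI)
  fix k :: nat and a b :: "nat \<Rightarrow> int" and C :: real
  assume asm: "k \<ge> 2 \<and> (\<forall>i\<in>{1..k}. a i > 0) \<and>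
       (\<forall>i j. 1 \<le> i \<and> i < j \<and> j \<le> k \<longrightarrow> a i * b j \<noteq> a j * b i)" and "C > 0"
  let ?S = "{n. n > 0 \<and> (\<forall>i\<in>{1..k}. a i * int n + b i > 0) \<and>
           (\<forall>i\<in>{1..k}. \<forall>j\<in>{1..k}. - int j < - int i \<longrightarrow>
              real (divisor_sum (nat (a i * int n + b i)))
                > C * real (divisor_sum (nat (a j * int n + b j))))}"
  let ?S' = "{n::nat. n > 0 \<and> (\<forall>i\<in>{1..k}. a i * int n + b i > 0) \<and>
            (\<forall>i\<in>{1..<k}. real (divisor_sum (nat (a i * int n + b i))) /
                 real (divisor_sum (nat (a (i+1) * int n + b (i+1)))) > C)}"
  have "a i * b j \<noteq> a j * b i" if "i \<in> {1..k}" "j \<in> {1..k}" "i \<noteq> j" for i j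
    using asm that by (metis atLeastAtMost_iff linorder_neqE_nat)
  hence "lower_density ?S > 0"
    using asm \<open>C > 0\<close> by (intro lower_density_ordered_divisor_sums) auto
  also have "?S \<subseteq> ?S'"
  proof
    fix n assume n: "n \<in> ?S"
    have "real (divisor_sum (nat (a i * int n + b i))) /
            real (divisor_sum (nat (a (i+1) * int n + b (i+1)))) > C" if "i \<in> {1..<k}" for i
    proof -
      have ii: "i \<in> {1..k}" "i + 1 \<in> {1..k}" "- int (i + 1) < - int i" using that by auto
      have "real (divisor_sum (nat (a i * int n + b i)))
              > C * real (divisor_sum (nat (a (i+1) * int n + b (i+1))))"
        using n ii by blast
      moreover have "a (i+1) * int n + b (i+1) > 0" using n ii by blast
      hence "divisor_sum (nat (a (i+1) * int n + b (i+1))) > 0" by (intro divisor_sum_pos) simp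
      ultimately show ?thesis by (simp add: pos_less_divide_eq)
    qed
    thus "n \<in> ?S'" using n by blast
  qed
  hence "lower_density ?S \<le> lower_density ?S'" by (rule lower_density_mono)
  finally show "lower_density ?S' > 0" .
next
  fix k :: nat and a b :: "nat \<Rightarrow> int"
  assume asm: "k \<ge> 2 \<and> (\<forall>i\<in>{1..k}. a i > 0) \<and>
       (\<forall>i j. 1 \<le> i \<and> i < j \<and> j \<le> k \<longrightarrow> a i * b j \<noteq> a j * b i)"
  let ?S = "{n. n > 0 \<and> (\<forall>i\<in>{1..k}. a i * int n + b i > 0) \<and>
           (\<forall>i\<in>{1..k}. \<forall>j\<in>{1..k}. - int j < - int i \<longrightarrow>
              real (divisor_sum (nat (a i * int n + b i)))
                > 1 * real (divisor_sum (nat (a j * int n + b j))))}"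
  let ?S' = "{n::nat. n > 0 \<and> (\<forall>i\<in>{1..k}. a i * int n + b i > 0) \<and>
         (\<forall>i\<in>{1..<k}. divisor_sum (nat (a i * int n + b i)) >
              divisor_sum (nat (a (i+1) * int n + b (i+1))))}"
  have "a i * b j \<noteq> a j * b i" if "i \<in> {1..k}" "j \<in> {1..k}" "i \<noteq> j" for i j
    using asm that by (metis atLeastAtMost_iff linorder_neqE_nat)
  hence "lower_density ?S > 0"
    using asm by (intro lower_density_ordered_divisor_sums) auto
  also have "?S \<subseteq> ?S'" by auto
  hence "lower_density ?S \<le> lower_density ?S'" by (rule lower_density_mono)
  finally show "lower_density ?S' > 0" .
next
  fix k :: nat and \<epsilon> :: "nat \<Rightarrow> int"
  assume asm: "k \<ge> 2 \<and> (\<forall>i\<in>{1..<k}. \<epsilon> i \<in> {-1, 1})"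
  \<comment> \<open>Then \<open>key i - key (i + 1) = \<epsilon> i\<close>, so the rank drops or rises as the sign demands.\<close>
  define key where "key i = - (\<Sum>l<i. \<epsilon> l)" for i :: nat
  have key: "key (i + 1) = key i - \<epsilon> i" for i by (simp add: key_def)
  let ?S = "{n. n > 0 \<and> (\<forall>i\<in>{1..k}. 1 * int n + int i > 0) \<and>
           (\<forall>i\<in>{1..k}. \<forall>j\<in>{1..k}. key j < key i \<longrightarrow>
              real (divisor_sum (nat (1 * int n + int i)))
                > 1 * real (divisor_sum (nat (1 * int n + int j))))}"
  let ?S' = "{n::nat. n > 0 \<and>
         (\<forall>i\<in>{1..<k}. \<epsilon> i * (int (divisor_sum (n + i)) - int (divisor_sum (n + (i+1)))) > 0)}"
  have "lower_density ?S > 0"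
    by (intro lower_density_ordered_divisor_sums) auto
  also have "?S \<subseteq> ?S'"
  proof
    fix n assume n: "n \<in> ?S"
    have less: "divisor_sum (n + j) < divisor_sum (n + i)"
      if "i \<in> {1..k}" "j \<in> {1..k}" "key j < key i" for i j
      using n that by (auto simp: nat_int_add)
    have "\<epsilon> i * (int (divisor_sum (n + i)) - int (divisor_sum (n + (i+1)))) > 0"
      if i: "i \<in> {1..<k}" for i
    proof -
      have "\<epsilon> i = 1 \<or> \<epsilon> i = -1" using asm i by blast
      thus ?thesis using less[of i "i + 1"] less[of "i + 1" i] i key[of i] by auto
    qed
    thus "n \<in> ?S'" using n by blast
  qed
  hence "lower_density ?S \<le> lower_density ?S'" by (rule lower_density_mono)
  finally show "lower_density ?S' > 0" .
next
  fix a b c d :: int and k :: nat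
  assume asm: "a > 0 \<and> c > 0 \<and> a * d \<noteq> b * c \<and> k > 0"
  hence "a > 0" "c > 0" "a * d \<noteq> b * c" by auto
  define u v where "u j = a * c * int j + b * c" and "v j = a * c * int j + a * d" for j :: nat
  \<comment> \<open>Equal values of \<open>u\<close> and \<open>v\<close> come from proportional forms, which share one index.\<close>
  define I where "I = u ` {1..k} \<union> v ` {1..k}"
  \<comment> \<open>The difference \<open>u j - v j\<close> equals \<open>b c - a d\<close> for all \<open>j\<close>; its sign decides the direction.\<close>
  define key where "key t = (if b * c > a * d then t else - t)" for t :: int
  define C where "C = real (divisor_sum (nat c))"
  have "C > 0" using divisor_sum_pos[of "nat c"] \<open>c > 0\<close> by (simp add: C_def)
  let ?S = "{n. n > 0 \<and> (\<forall>t\<in>I. (a * c) * int n + t > 0) \<and>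
           (\<forall>s\<in>I. \<forall>t\<in>I. key t < key s \<longrightarrow>
              real (divisor_sum (nat ((a * c) * int n + s)))
                > C * real (divisor_sum (nat ((a * c) * int n + t))))}"
  let ?S' = "{n::nat. n > 0 \<and>
         (\<forall>j\<in>{1..k}. a * int (n + j) + b > 0 \<and> c * int (n + j) + d > 0) \<and>
         (\<forall>j\<in>{1..k}. divisor_sum (nat (a * int (n + j) + b)) >
              divisor_sum (nat (c * int (n + j) + d)))}"
  have "lower_density ?S > 0"
    using \<open>a > 0\<close> \<open>c > 0\<close> \<open>C > 0\<close>
    by (intro lower_density_ordered_divisor_sums) (auto simp: I_def)
  also have "?S \<subseteq> ?S'"
  proof
    fix n assume n: "n \<in> ?S"
    have "a * int (n + j) + b > 0 \<and> c * int (n + j) + d > 0 \<and>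
          divisor_sum (nat (a * int (n + j) + b)) > divisor_sum (nat (c * int (n + j) + d))"
      if j: "j \<in> {1..k}" for j
    proof -
      define p q where "p = a * int (n + j) + b" and "q = c * int (n + j) + d"
      have uv: "u j \<in> I" "v j \<in> I" using j by (auto simp: I_def)
      have cp: "(a * c) * int n + u j = c * p" and aq: "(a * c) * int n + v j = a * q"
        by (simp_all add: u_def v_def p_def q_def algebra_simps)
      have "c * p > 0" "a * q > 0" using n uv unfolding cp[symmetric] aq[symmetric] by blast+
      hence pq: "p > 0" "q > 0" using \<open>a > 0\<close> \<open>c > 0\<close> by (auto simp: zero_less_mult_iff)
      have "key (v j) < key (u j)"
        using \<open>a * d \<noteq> b * c\<close> by (auto simp: key_def u_def v_def)
      hence "C * real (divisor_sum (nat (a * q))) < real (divisor_sum (nat (c * p)))"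
        using n uv unfolding cp[symmetric] aq[symmetric] by blast
      also have "divisor_sum (nat (c * p)) \<le> divisor_sum (nat c) * divisor_sum (nat p)"
        using divisor_sum_mult_le[of "nat c" "nat p"] pq \<open>c > 0\<close> by (simp add: nat_mult_distrib)
      hence "real (divisor_sum (nat (c * p))) \<le> C * real (divisor_sum (nat p))"
        unfolding C_def by (metis of_nat_le_iff of_nat_mult)
      finally have "divisor_sum (nat (a * q)) < divisor_sum (nat p)"
        using \<open>C > 0\<close> by simp
      moreover have "divisor_sum (nat q) \<le> divisor_sum (nat (a * q))"
        using pq \<open>a > 0\<close> by (intro divisor_sum_mono_dvd) (auto simp: nat_mult_distrib)
      ultimately show ?thesis using pq unfolding p_def q_def by linarith
    qed
    thus "n \<in> ?S'" using n by blast
  qed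
  hence "lower_density ?S \<le> lower_density ?S'" by (rule lower_density_mono)
  finally show "lower_density ?S' > 0" .
qed

end
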